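(* Let $k>1$ and $q>2$ be integers and let $S_k(q)$ be the $\mathbb{Q}$-linear span of the numbers $\zeta(k,a/q)/\pi^k$ for $1\le a<q$, $\gcd(a,q)=1$. Then $$\dim_{\mathbb{Q}}S_k(q)\ge\frac{\varphi(q)}{2}.$$
   Context: For $0<x\le1$ and $\Re(s)>1$, the Hurwitz zeta function is $\zeta(s,x)=\sum_{n\ge0}(n+x)^{-s}$. $\varphi$ is Euler's totient function. *)

theory Defs
  imports "HOL-Analysis.Analysis" "HOL-Number_Theory.Totient"
begin

text \<open>Meaningful for \<open>Re s > 1\<close> and \<open>0 < x \<le> 1\<close>, where the series converges absolutely; the base
  of each power is a positive real, so \<open>powr\<close> agrees with the usual \<open>exp (- s * ln (n + x))\<close>.\<close>

definition hurwitz_zeta :: "complex \<Rightarrow> real \<Rightarrow> complex" where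
  "hurwitz_zeta s x = (\<Sum>n. complex_of_real (real n + x) powr (- s))"

definition rat_scale :: "rat \<Rightarrow> complex \<Rightarrow> complex" where
  "rat_scale r z = of_rat r * z"

global_interpretation rat_space: vector_space rat_scale
  by unfold_locales (simp_all add: rat_scale_def algebra_simps of_rat_add of_rat_mult)

definition S :: "nat \<Rightarrow> nat \<Rightarrow> complex set" where
  "S k q = rat_space.span
     {hurwitz_zeta (of_nat k) (real a / real q) / of_real pi ^ k | a.
        1 \<le> a \<and> a < q \<and> coprime a q}"

end

theory Submission
  imports Defs "HOL-Computational_Algebra.Polynomial"
begin

text \<open>The span contains the numbers \<open>c a = (\<zeta>(k, a/q) + (-1)^k \<zeta>(k, 1 - a/q)) / \<pi>^k\<close>, and the at least
  \<open>\<phi>(q)/2\<close> of them with \<open>0 < a < q/2\<close>, \<open>a\<close> coprime to \<open>q\<close>, are linearly independent. Differentiating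
  the reflection formula of the Gamma function gives \<open>c a = (2\<i>)^k P (w^a)\<close> with \<open>P\<close> a rational
  polynomial and \<open>w = exp (2\<pi>\<i>/q)\<close>. So a rational relation \<open>\<Sum>a. r a * c a = 0\<close> may be conjugated to
  \<open>\<Sum>a. r a * c (a * b) = 0\<close> for every \<open>b\<close> coprime to \<open>q\<close>. Now \<open>\<zeta>(k, 1/q)\<close> exceeds the sum of the
  other \<open>\<zeta>(k, j/q)\<close>, \<open>2 \<le> j \<le> q\<close>, because \<open>\<zeta>(k) \<le> \<zeta>(2) < 2\<close>; this diagonal dominance forces
  \<open>r = 0\<close>, without characters or \<open>L\<close>-values.\<close>

section \<open>Conjugation of roots of unity\<close>

definition subring_set :: "'a::idom set \<Rightarrow> bool" where
  "subring_set R \<longleftrightarrow> 0 \<in> R \<and> 1 \<in> R \<and> (\<forall>x\<in>R. \<forall>y\<in>R. x + y \<in> R \<and> x * y \<in> R)"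

definition coeffs_in :: "'a::idom set \<Rightarrow> 'a poly \<Rightarrow> bool" where
  "coeffs_in R p \<longleftrightarrow> (\<forall>i. coeff p i \<in> R)"

lemma subring_set_Ints: "subring_set (\<int> :: 'a::idom set)"
  by (simp add: subring_set_def)

lemma subring_set_Rats: "subring_set (\<rat> :: 'a::field_char_0 set)"
  by (simp add: subring_set_def)

context
  fixes R :: "'a::idom set"
  assumes R: "subring_set R"
begin

lemma subring_set_sum: "(\<And>i. i \<in> A \<Longrightarrow> f i \<in> R) \<Longrightarrow> sum f A \<in> R"
  using R by (induction A rule: infinite_finite_induct) (auto simp: subring_set_def)

lemma subring_set_power: "x \<in> R \<Longrightarrow> x ^ n \<in> R"
  using R by (induction n) (auto simp: subring_set_def)

lemma subring_set_of_nat: "of_nat n \<in> R"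
  using R by (induction n) (auto simp: subring_set_def)

lemma coeffs_in_pCons: "coeffs_in R (pCons a p) \<longleftrightarrow> a \<in> R \<and> coeffs_in R p"
  unfolding coeffs_in_def by (metis coeff_pCons_0 coeff_pCons_Suc not0_implies_Suc)

lemma coeffs_in_0: "coeffs_in R 0"
  using R by (simp add: coeffs_in_def subring_set_def)

lemma coeffs_in_add: "coeffs_in R p \<Longrightarrow> coeffs_in R r \<Longrightarrow> coeffs_in R (p + r)"
  using R by (simp add: coeffs_in_def subring_set_def)

lemma coeffs_in_mult: "coeffs_in R p \<Longrightarrow> coeffs_in R r \<Longrightarrow> coeffs_in R (p * r)"
  using R unfolding coeffs_in_def coeff_mult by (intro allI subring_set_sum) (simp add: subring_set_def)

lemma coeffs_in_smult: "c \<in> R \<Longrightarrow> coeffs_in R p \<Longrightarrow> coeffs_in R (smult c p)"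
  using R by (simp add: coeffs_in_def subring_set_def)

lemma coeffs_in_monom: "c \<in> R \<Longrightarrow> coeffs_in R (monom c n)"
  using R by (simp add: coeffs_in_def subring_set_def)

text \<open>This lets \<open>subring_set_sum\<close> and \<open>binomial_prime_mod\<close> be
  applied one level up, to polynomials over \<open>R\<close>.\<close>

lemma subring_set_coeffs_in: "subring_set {p. coeffs_in R p}"
  unfolding subring_set_def
  using R coeffs_in_monom[of 1 0]
  by (auto intro: coeffs_in_0 coeffs_in_add coeffs_in_mult simp: monom_0 one_pCons subring_set_def)

lemma coeffs_in_pcompose: "coeffs_in R p \<Longrightarrow> coeffs_in R r \<Longrightarrow> coeffs_in R (pcompose p r)"
proof (induction p)
  case (pCons a p)
  then show ?case
    using coeffs_in_0
    by (auto simp: pcompose_pCons coeffs_in_pCons intro!: coeffs_in_add coeffs_in_mult)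
qed (simp add: coeffs_in_0)

lemma coeffs_in_pderiv: "coeffs_in R p \<Longrightarrow> coeffs_in R (pderiv p)"
  using R subring_set_of_nat unfolding coeffs_in_def coeff_pderiv
  by (simp only: subring_set_def) blast

section \<open>Congruences modulo a prime\<close>

text \<open>The inner binomial coefficients are divisible by \<open>p\<close>. The cofactor is kept
  inside \<open>R\<close>, so that the result reads as a congruence modulo \<open>p\<close> in
  \<open>R\<close>, for integers and for integral polynomials alike.\<close>

lemma binomial_prime_mod:
  assumes p: "prime p" and xy: "x \<in> R" "y \<in> R"
  shows "\<exists>h\<in>R. (x + y) ^ p = x ^ p + y ^ p + of_nat p * h"
proof
  define c where "c k = (p choose k) div p" for k
  let ?h = "\<Sum>k\<in>{1..<p}. of_nat (c k) * (x ^ k * y ^ (p - k))"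
  have p0: "p > 1" using p prime_gt_1_nat by blast
  have c: "of_nat (p choose k) = (of_nat p * of_nat (c k) :: 'a)" if "k \<in> {1..<p}" for k
  proof -
    have "p dvd (p choose k)"
      by (rule dvd_choose_prime) (use that p in auto)
    then show ?thesis unfolding c_def by (metis dvd_mult_div_cancel of_nat_mult)
  qed
  have "{..p} = insert 0 (insert p {1..<p})" using p0 by auto
  then have "(x + y) ^ p
      = x ^ p + y ^ p + (\<Sum>k\<in>{1..<p}. of_nat (p choose k) * x ^ k * y ^ (p - k))"
    using p0 by (simp add: binomial_ring)
  also have "(\<Sum>k\<in>{1..<p}. of_nat (p choose k) * x ^ k * y ^ (p - k)) = of_nat p * ?h"
    unfolding sum_distrib_left by (intro sum.cong) (simp_all add: c mult.assoc)
  finally show "(x + y) ^ p = x ^ p + y ^ p + of_nat p * ?h" .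
  show "?h \<in> R"
    using R xy subring_set_power subring_set_of_nat
    by (intro subring_set_sum) (simp add: subring_set_def)
qed

end

text \<open>Fermat's little theorem for the image of the integers in \<open>'a\<close>. By the
  binomial congruence the property \<open>F\<close> is additive, so it spreads from 0, 1 and -1 to
  all integers.\<close>

lemma Ints_fermat:
  fixes a :: "'a::idom"
  assumes p: "prime p" and "a \<in> \<int>"
  shows "\<exists>h\<in>\<int>. a - a ^ p = of_nat p * h"
proof -
  define F where "F x \<longleftrightarrow> x \<in> \<int> \<and> (\<exists>h\<in>\<int>. x - x ^ p = of_nat p * h)" for x :: 'a
  note binomial = binomial_prime_mod[OF subring_set_Ints p]
  have p0: "p > 0" using p by (rule prime_gt_0_nat)
  have F_add: "F (x + y)" if "F x" "F y" for x y
  proof -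
    have xy: "x \<in> \<int>" "y \<in> \<int>"
      and "\<exists>h\<in>\<int>. x - x ^ p = of_nat p * h" "\<exists>l\<in>\<int>. y - y ^ p = of_nat p * l"
      using that by (simp_all only: F_def)
    then obtain h l where hl: "h \<in> \<int>" "x - x ^ p = of_nat p * h" "l \<in> \<int>" "y - y ^ p = of_nat p * l"
      by metis
    obtain m where m: "m \<in> \<int>" "(x + y) ^ p = x ^ p + y ^ p + of_nat p * m"
      using binomial[OF xy] by auto
    have "x + y - (x + y) ^ p = (x - x ^ p) + (y - y ^ p) - of_nat p * m" unfolding m(2) by simp
    also have "\<dots> = of_nat p * (h + l - m)" unfolding hl by (simp add: algebra_simps)
    finally have "x + y - (x + y) ^ p = of_nat p * (h + l - m)" .
    moreover have "x + y \<in> \<int>" "h + l - m \<in> \<int>" using xy hl m(1) by auto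
    ultimately show ?thesis unfolding F_def by blast
  qed
  have F0: "F 0" and F1: "F 1" using p0 by (auto simp: F_def intro!: bexI[of _ 0])
  have Fm1: "F (- 1)"
  proof -
    \<comment> \<open>Expanding the p-th power of 1 + (-1) = 0 evaluates the p-th power of -1 modulo
      \<open>p\<close> without a case split on the parity of \<open>p\<close>.\<close>
    obtain m :: 'a where m: "m \<in> \<int>" "(1 + - 1) ^ p = 1 ^ p + (- 1) ^ p + of_nat p * m"
      using binomial[of 1 "- 1"] by auto
    have "(- 1) - (- 1) ^ p = of_nat p * m - (1 + - 1 :: 'a) ^ p" unfolding m(2) by simp
    also have "\<dots> = of_nat p * m" using p0 by simp
    finally show ?thesis using m(1) unfolding F_def by auto
  qed
  have "F (of_int i)" for i
  proof (induction i rule: int_induct[of _ 0])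
    case (step1 i)
    then show ?case using F_add[OF _ F1] by simp
  next
    case (step2 i)
    then show ?case using F_add[OF _ Fm1] by simp
  qed (simp add: F0)
  then show ?thesis using \<open>a \<in> \<int>\<close> unfolding F_def by (auto elim: Ints_cases)
qed

text \<open>The Frobenius congruence. Write the polynomial as a + X g: the p-th power is additive
  modulo \<open>p\<close>, fixes the constant a by Fermat, and turns X into X^p.\<close>

lemma pcompose_prime_mod:
  fixes g :: "'a::idom poly"
  assumes p: "prime p" and "coeffs_in \<int> g"
  shows "\<exists>h. coeffs_in \<int> h \<and> pcompose g (monom 1 p) = g ^ p + of_nat p * h"
  using assms(2)
proof (induction g)
  case 0
  show ?case using p prime_gt_0_nat
    by (intro exI[of _ 0]) (auto simp: coeffs_in_0[OF subring_set_Ints] power_0_left)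
next
  case (pCons a g)
  let ?X = "monom 1 1 :: 'a poly"
  note Z = subring_set_Ints
  have aZ: "a \<in> \<int>" and gZ: "coeffs_in \<int> g" using pCons.prems by (simp_all add: coeffs_in_pCons[OF Z])
  obtain h where h: "coeffs_in \<int> h" "pcompose g (monom 1 p) = g ^ p + of_nat p * h"
    using pCons.IH gZ by blast
  obtain m where m: "m \<in> \<int>" "a - a ^ p = of_nat p * m" using Ints_fermat[OF p aZ] by blast
  have XZ: "coeffs_in \<int> (monom 1 n :: 'a poly)" for n by (rule coeffs_in_monom[OF Z]) simp
  have *: "pCons a g = [:a:] + ?X * g" by (simp add: monom_altdef)
  have "coeffs_in \<int> [:a:]" using aZ by (simp add: coeffs_in_pCons[OF Z] coeffs_in_0[OF Z])
  then obtain l where l: "coeffs_in \<int> l" "pCons a g ^ p = [:a:] ^ p + (?X * g) ^ p + of_nat p * l"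
    using binomial_prime_mod[OF subring_set_coeffs_in[OF Z] p, of "[:a:]" "?X * g"]
      coeffs_in_mult[OF Z XZ gZ, of 1] unfolding * by auto
  have "pcompose (pCons a g) (monom 1 p) = [:a:] + monom 1 p * (g ^ p + of_nat p * h)"
    by (simp add: pcompose_pCons h)
  also have "[:a:] = [:a:] ^ p + of_nat p * [:m:]"
    using m(2) by (simp add: poly_const_pow of_nat_poly diff_eq_eq add.commute mult.commute)
  also have "monom 1 p = ?X ^ p" by (simp add: monom_power)
  also have "([:a:] ^ p + of_nat p * [:m:]) + ?X ^ p * (g ^ p + of_nat p * h)
      = pCons a g ^ p + of_nat p * ([:m:] + ?X ^ p * h - l)"
    unfolding l by (simp add: algebra_simps power_mult_distrib)
  finally have eq: "pcompose (pCons a g) (monom 1 p)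
      = pCons a g ^ p + of_nat p * ([:m:] + monom 1 p * h + smult (-1) l)"
    by (simp add: monom_power)
  have "coeffs_in \<int> ([:m:] + monom 1 p * h + smult (-1) l)"
    using m(1) by (intro coeffs_in_add[OF Z] coeffs_in_mult[OF Z] coeffs_in_smult[OF Z] XZ h l)
      (simp_all add: coeffs_in_pCons[OF Z] coeffs_in_0[OF Z])
  with eq show ?case by blast
qed

section \<open>Denominators and Galois conjugation\<close>

lemma common_denominator:
  assumes "finite I"
  obtains D :: nat where "D > 0" "\<And>i. i \<in> I \<Longrightarrow> of_nat D * (r i :: rat) \<in> \<int>"
proof -
  define d where "d i = nat (snd (quotient_of (r i)))" for i
  have d0: "d i > 0" for i unfolding d_def using quotient_of_denom_pos'[of "r i"] by simp
  have di: "of_nat (d i) * r i \<in> \<int>" for i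
  proof -
    obtain a b where ab: "quotient_of (r i) = (a, b)" by force
    then have r: "r i = of_int a / of_int b" and b: "b > 0"
      by (auto simp: quotient_of_div quotient_of_denom_pos)
    have "d i = nat b" by (simp add: d_def ab)
    then have "of_nat (d i) * r i = of_int a" using b by (simp add: r)
    then show ?thesis by simp
  qed
  show ?thesis
  proof
    show "prod d I > 0" using d0 by (simp add: prod_pos)
    fix i assume "i \<in> I"
    then have "of_nat (prod d I) * r i = of_nat (prod d (I - {i})) * (of_nat (d i) * r i)"
      using assms by (simp add: prod.remove mult.commute mult.left_commute)
    also have "\<dots> \<in> \<int>" by (rule Ints_mult[OF Ints_of_nat di])
    finally show "of_nat (prod d I) * r i \<in> \<int>" .
  qed
qed

lemma coeffs_in_Rats_clear:
  fixes g :: "complex poly"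
  assumes "coeffs_in \<rat> g"
  obtains D :: nat where "D > 0" "coeffs_in \<int> (smult (of_nat D) g)"
proof -
  have "\<forall>i. \<exists>r. coeff g i = of_rat r"
    using assms by (auto simp: coeffs_in_def elim: Rats_cases)
  then obtain r where r: "\<And>i. coeff g i = of_rat (r i)" by metis
  obtain D where D: "D > 0" "\<And>i. i \<in> {..degree g} \<Longrightarrow> of_nat D * r i \<in> \<int>"
    using common_denominator[of "{..degree g}" r] by auto
  have "coeff (smult (of_nat D) g) i \<in> \<int>" for i
  proof (cases "i \<le> degree g")
    case True
    then obtain m where "of_nat D * r i = of_int m" using D(2) by (auto elim: Ints_cases)
    then have "coeff (smult (of_nat D) g) i = of_int m"
      by (metis coeff_smult of_rat_mult of_rat_of_int_eq of_rat_of_nat_eq r)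
    then show ?thesis by simp
  qed (simp add: coeff_eq_0)
  then show ?thesis using that D(1) by (simp add: coeffs_in_def)
qed

lemma root_of_unity_mod:
  fixes w :: "'a::monoid_mult"
  assumes "w ^ q = 1"
  shows "w ^ n = w ^ (n mod q)"
proof -
  have "w ^ n = w ^ (q * (n div q) + n mod q)" by simp
  also have "\<dots> = w ^ (n mod q)" by (simp only: power_add power_mult assms power_one mult_1)
  finally show ?thesis .
qed

text \<open>A rational linear functional taking the value \<open>1\<close> at \<open>v\<close> is integral on \<open>\<int>[w]\<close> up to a common
  denominator \<open>D\<close>, so \<open>v \<in> n\<int>[w]\<close> forces \<open>n\<close> to divide \<open>D\<close>.\<close>

lemma cyclotomic_divisors_bounded:
  fixes w v :: complex
  assumes q: "q > 0" "w ^ q = 1" and v: "v \<noteq> 0"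
  shows "\<exists>D. \<forall>n h. coeffs_in \<int> h \<longrightarrow> v = of_nat n * poly h w \<longrightarrow> n \<le> D"
proof -
  have ind: "rat_space.independent {v}" using v by (simp add: rat_space.dependent_single)
  \<comment> \<open>The functional is the \<open>v\<close>-coordinate with respect to a rational
    basis of the complex numbers that contains \<open>v\<close>.\<close>
  define B where "B = rat_space.extend_basis {v}"
  have B: "rat_space.independent B" "rat_space.span B = UNIV" "v \<in> B"
    using rat_space.independent_extend_basis[OF ind] rat_space.span_extend_basis[OF ind]
      rat_space.extend_basis_superset[OF ind] by (auto simp: B_def)
  define f where "f x = rat_space.representation B x v" for x
  have fv: "f v = 1" unfolding f_def using rat_space.representation_basis[OF B(1,3)] by simp
  have f_scale: "f (of_rat r * x) = r * f x" for r x
    unfolding f_def using rat_space.representation_scale[OF B(1), of x r] B(2)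
    by (simp add: rat_scale_def)
  have f_sum: "f (\<Sum>i\<in>I. g i) = (\<Sum>i\<in>I. f (g i))" for I and g :: "nat \<Rightarrow> complex"
    unfolding f_def using rat_space.representation_sum[OF B(1), of I g] B(2) by simp
  obtain D where D: "D > 0" "\<And>i. i \<in> {..<q} \<Longrightarrow> of_nat D * f (w ^ i) \<in> \<int>"
    using common_denominator[of "{..<q}" "\<lambda>i. f (w ^ i)"] by auto
  have "n \<le> D" if h: "coeffs_in \<int> h" and eq: "v = of_nat n * poly h w" for n h
  proof -
    have Di: "of_nat D * f (w ^ i) \<in> \<int>" for i
      using D(2)[of "i mod q"] q root_of_unity_mod[OF q(2), of i] by simp
    have "\<forall>i. \<exists>m. coeff h i = of_int m"
      using h by (auto simp: coeffs_in_def elim: Ints_cases)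
    then obtain c where c: "\<And>i. coeff h i = of_int (c i)" by metis
    have "f (poly h w) = (\<Sum>i\<le>degree h. f (of_rat (of_int (c i)) * w ^ i))"
      by (simp add: poly_altdef f_sum c)
    also have "\<dots> = (\<Sum>i\<le>degree h. of_int (c i) * f (w ^ i))" by (simp only: f_scale)
    finally have "of_nat D * f (poly h w) = (\<Sum>i\<le>degree h. of_int (c i) * (of_nat D * f (w ^ i)))"
      by (simp only: sum_distrib_left mult.left_commute)
    also have "\<dots> \<in> \<int>" by (intro Ints_sum Ints_mult Di) auto
    finally obtain t where t: "of_nat D * f (poly h w) = of_int t" by (auto elim: Ints_cases)
    have "f v = of_nat n * f (poly h w)" using f_scale[of "of_nat n" "poly h w"] eq by simp
    then have "of_nat D = of_nat n * (of_nat D * f (poly h w))" using fv by (simp add: mult.left_commute)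
    then have "of_nat D = (of_nat n * of_int t :: rat)" unfolding t .
    then have "(of_int (int D) :: rat) = of_int (int n * t)" by simp
    then have "int D = int n * t" by (simp only: of_int_eq_iff)
    then show "n \<le> D" using D(1) by (metis dvd_imp_le dvd_triv_left int_dvd_int_iff)
  qed
  then show ?thesis by blast
qed

text \<open>Take k = b + q * \<Prod>T, where \<open>T\<close> consists of the primes up to
  \<open>A\<close> not dividing \<open>b\<close>. A prime up to \<open>A\<close> divides exactly one
  of the two summands: \<open>b\<close> if it is not in \<open>T\<close>, the other one if it
  is.\<close>

lemma rough_cong_exists:
  fixes b q A :: nat
  assumes "coprime b q" "q > 0"
  obtains k where "k > 0" "[k = b] (mod q)" "\<And>p. prime p \<Longrightarrow> p dvd k \<Longrightarrow> p > A"
proof -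
  define T where "T = {p. prime p \<and> p \<le> A \<and> \<not> p dvd b}"
  have fin: "finite T" by (rule finite_subset[of _ "{..A}"]) (auto simp: T_def)
  have "p > A" if p: "prime p" and dvd: "p dvd b + q * \<Prod>T" for p
  proof (rule ccontr)
    assume "\<not> p > A"
    show False
    proof (cases "p dvd b")
      case True
      then have "p dvd q * \<Prod>T" using dvd by (simp add: dvd_add_right_iff)
      moreover have "\<not> p dvd q" using True assms p
        using coprime_common_divisor not_prime_unit by blast
      ultimately have "p dvd \<Prod>T" using p prime_dvd_mult_iff by blast
      then obtain r where "r \<in> T" "p dvd r" using prime_dvd_prod_iff[OF fin p, of "\<lambda>x. x"] by auto
      then show False using True p primes_dvd_imp_eq by (auto simp: T_def)
    next
      case False
      then have "p \<in> T" using p \<open>\<not> p > A\<close> by (simp add: T_def)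
      then have "p dvd \<Prod>T" using fin by (rule dvd_prodI[rotated])
      then show False using dvd False by (simp add: dvd_add_left_iff)
    qed
  qed
  moreover have "\<Prod>T > 0" by (rule prod_pos) (auto simp: T_def prime_gt_0_nat)
  ultimately show ?thesis
    using that[of "b + q * \<Prod>T"] assms(2) by (simp add: cong_def)
qed

text \<open>Landau's argument. For a prime \<open>p\<close>, \<open>g (w ^ p)\<close> is divisible by \<open>p\<close>, and as it is one of the
  finitely many values \<open>g (w ^ j)\<close>, \<open>j < q\<close>, it vanishes once \<open>p\<close> is large. It remains to choose a
  representative of \<open>b\<close> modulo \<open>q\<close> without small prime factors.\<close>

lemma root_of_unity_conj_Ints:
  fixes w :: complex
  assumes q: "q > 0" "w ^ q = 1" and g: "coeffs_in \<int> g" "poly g w = 0" and b: "coprime b q"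
  shows "poly g (w ^ b) = 0"
proof -
  have "\<exists>D. \<forall>n h. coeffs_in \<int> h \<longrightarrow> poly g (w ^ j) = of_nat n * poly h w \<longrightarrow>
      poly g (w ^ j) = 0 \<or> n \<le> D" for j
    using cyclotomic_divisors_bounded[OF q, of "poly g (w ^ j)"] by blast
  then obtain D where D: "\<And>j n h. coeffs_in \<int> h \<Longrightarrow> poly g (w ^ j) = of_nat n * poly h w \<Longrightarrow>
      poly g (w ^ j) = 0 \<or> n \<le> D j" by metis
  \<comment> \<open>The bound \<open>D j\<close> depends on the value at \<open>w ^ j\<close>; only
    residues modulo \<open>q\<close> matter, so one bound serves all exponents.\<close>
  define A where "A = Max (D ` {..<q})"
  have DA: "D (j mod q) \<le> A" for j unfolding A_def using q(1) by (intro Max_ge) auto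
  \<comment> \<open>The vanishing is carried from exponent l to l * p, one large prime factor of
    \<open>k\<close> at a time.\<close>
  have zero: "poly g (w ^ k) = 0" if "k > 0" "\<And>p. prime p \<Longrightarrow> p dvd k \<Longrightarrow> p > A" for k
    using that
  proof (induction k rule: less_induct)
    case (less k)
    show ?case
    proof (cases "k = 1")
      case True
      then show ?thesis using g by simp
    next
      case False
      then obtain p where p: "prime p" "p dvd k" using prime_factor_nat by blast
      then obtain l where k: "k = l * p" by (auto simp: dvd_def mult.commute)
      have l: "l > 0" "l < k" using less.prems(1) k p prime_gt_1_nat by (auto simp: k)
      have "poly g (w ^ l) = 0" using less.IH[OF l(2,1)] less.prems(2) by (simp add: k)
      \<comment> \<open>Substituting X^l moves the known zero from \<open>w ^ l\<close> to
        \<open>w\<close>. The Frobenius congruence then writes the value of \<open>g\<close> at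
        \<open>w ^ k\<close> as \<open>p\<close> times an integral polynomial at \<open>w\<close>
        itself, as the bound \<open>D\<close> requires.\<close>
      define g' where "g' = pcompose g (monom 1 l)"
      have g': "coeffs_in \<int> g'" unfolding g'_def
        by (intro coeffs_in_pcompose[OF subring_set_Ints] g coeffs_in_monom[OF subring_set_Ints]) simp
      obtain h where h: "coeffs_in \<int> h" "pcompose g' (monom 1 p) = g' ^ p + of_nat p * h"
        using pcompose_prime_mod[OF p(1) g'] by blast
      have "poly (pcompose g' (monom 1 p)) w = poly g (w ^ k)"
        by (simp add: g'_def poly_pcompose poly_monom k power_mult[symmetric] mult.commute)
      moreover have "poly g' w ^ p = 0"
        using \<open>poly g (w ^ l) = 0\<close> prime_gt_0_nat[OF p(1)]
        by (simp add: g'_def poly_pcompose poly_monom)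
      ultimately have eq: "poly g (w ^ (k mod q)) = of_nat p * poly h w"
        using root_of_unity_mod[OF q(2), of k] by (simp add: h(2))
      have "\<not> p \<le> D (k mod q)" using less.prems(2)[OF p] DA[of k] by simp
      then show ?thesis using D[OF h(1) eq] root_of_unity_mod[OF q(2), of k] by simp
    qed
  qed
  obtain k where k: "k > 0" "[k = b] (mod q)" "\<And>p. prime p \<Longrightarrow> p dvd k \<Longrightarrow> p > A"
    using rough_cong_exists[OF b q(1), of A] by blast
  have "w ^ b = w ^ k"
    using k(2) root_of_unity_mod[OF q(2), of b] root_of_unity_mod[OF q(2), of k]
    by (simp add: cong_def)
  then show ?thesis using zero k by simp
qed

lemma root_of_unity_conj:
  fixes w :: complex
  assumes q: "q > 0" "w ^ q = 1" and g: "coeffs_in \<rat> g" "poly g w = 0" and b: "coprime b q"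
  shows "poly g (w ^ b) = 0"
proof -
  obtain D :: nat where D: "D > 0" "coeffs_in \<int> (smult (of_nat D) g)"
    using coeffs_in_Rats_clear[OF g(1)] by blast
  have "poly (smult (of_nat D) g) (w ^ b) = 0"
    by (rule root_of_unity_conj_Ints[OF q D(2) _ b]) (simp add: g(2))
  then show ?thesis using D(1) by simp
qed

section \<open>Reflected Hurwitz zeta values\<close>

text \<open>Differentiate both sides of Gamma(z) Gamma(1 - z) = pi / sin(pi z) and divide by this
  product.\<close>

lemma Digamma_reflection:
  fixes z :: complex
  assumes z: "z \<notin> \<int>"
  shows "Digamma (1 - z) - Digamma z = of_real pi * cot (of_real pi * z)"
proof -
  have z1: "1 - z \<notin> \<int>" using z by (metis Ints_1 Ints_diff diff_diff_eq2 add_diff_cancel_left')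
  then have nz: "z \<notin> \<int>\<^sub>\<le>\<^sub>0" "1 - z \<notin> \<int>\<^sub>\<le>\<^sub>0" using z nonpos_Ints_Int by blast+
  have s: "sin (of_real pi * z) \<noteq> 0" using z by (auto simp: sin_eq_0 mult.commute)
  have "((\<lambda>z. Gamma z * Gamma (1 - z)) has_field_derivative
      Gamma z * Gamma (1 - z) * (Digamma z - Digamma (1 - z))) (at z)"
    using nz by (auto intro!: derivative_eq_intros simp: algebra_simps)
  moreover have "((\<lambda>z. Gamma z * Gamma (1 - z)) has_field_derivative
      - (of_real pi)\<^sup>2 * cos (of_real pi * z) / (sin (of_real pi * z))\<^sup>2) (at z)"
    unfolding Gamma_reflection_complex using s
    by (auto intro!: derivative_eq_intros simp: power2_eq_square)
  ultimately have "of_real pi / sin (of_real pi * z) * (Digamma z - Digamma (1 - z))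
      = - (of_real pi)\<^sup>2 * cos (of_real pi * z) / (sin (of_real pi * z))\<^sup>2"
    using DERIV_unique by (metis Gamma_reflection_complex)
  then have "Digamma z - Digamma (1 - z) = sin (of_real pi * z) / of_real pi *
      (- (of_real pi)\<^sup>2 * cos (of_real pi * z) / (sin (of_real pi * z))\<^sup>2)"
    using s by (simp add: field_simps)
  also have "\<dots> = - (of_real pi * cot (of_real pi * z))"
    using s by (simp add: cot_def power2_eq_square)
  finally show ?thesis by (simp add: algebra_simps)
qed

text \<open>Introduces the variable v = 1 / (exp(2 pi i z) - 1), in which differentiation preserves
  polynomials.\<close>

lemma cot_exp:
  fixes z :: complex
  assumes z: "z \<notin> \<int>"
  shows "of_real pi * cot (of_real pi * z) =
      2 * of_real pi * \<i> * (1 / 2 + 1 / (exp (2 * of_real pi * \<i> * z) - 1))"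
    and "exp (2 * of_real pi * \<i> * z) \<noteq> 1"
proof -
  define u where "u = exp (\<i> * (of_real pi * z))"
  have u0: "u \<noteq> 0" by (simp add: u_def)
  have e: "exp (2 * of_real pi * \<i> * z) = u\<^sup>2"
    by (simp add: u_def exp_double[symmetric] mult_ac)
  have inv: "exp (- (\<i> * (of_real pi * z))) = 1 / u" by (simp add: u_def exp_minus inverse_eq_divide)
  have "sin (of_real pi * z) \<noteq> 0" using z by (auto simp: sin_eq_0 mult.commute)
  moreover have sin: "sin (of_real pi * z) = (u - 1 / u) / (2 * \<i>)"
    unfolding sin_exp_eq using inv by (simp add: u_def)
  ultimately have u2: "u\<^sup>2 - 1 \<noteq> 0" using u0 by (auto simp: field_simps power2_eq_square)
  then show "exp (2 * of_real pi * \<i> * z) \<noteq> 1" by (simp add: e)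
  have cos: "cos (of_real pi * z) = (u + 1 / u) / 2"
    unfolding cos_exp_eq using inv by (simp add: u_def)
  have "cot (of_real pi * z) = \<i> * (u\<^sup>2 + 1) / (u\<^sup>2 - 1)"
    unfolding cot_def sin cos using u0 u2 by (simp add: divide_simps power2_eq_square)
  then show "of_real pi * cot (of_real pi * z) =
      2 * of_real pi * \<i> * (1 / 2 + 1 / (exp (2 * of_real pi * \<i> * z) - 1))"
    unfolding e using u2 by (simp add: divide_simps) (simp add: algebra_simps)
qed

text \<open>With c = 2 pi i the variable v satisfies v' = -c (v + v^2). Each differentiation thus
  yields one more factor c and replaces P by -(X + X^2) P'. The alternating sign comes from the
  inner derivative of 1 - z.\<close>

lemma Polygamma_reflection_poly:
  "\<exists>P. coeffs_in \<rat> P \<and> (\<forall>z. z \<notin> \<int> \<longrightarrow>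
     (-1) ^ n * Polygamma n (1 - z) - Polygamma n z
       = (2 * of_real pi * \<i>) ^ Suc n * poly P (1 / (exp (2 * of_real pi * \<i> * z) - 1)))"
proof (induction n)
  case 0
  show ?case
    by (rule exI[of _ "[:1/2, 1:]"])
      (auto simp: Digamma_reflection cot_exp coeffs_in_pCons[OF subring_set_Rats] coeffs_in_0[OF subring_set_Rats])
next
  case (Suc n)
  let ?c = "2 * of_real pi * \<i> :: complex"
  let ?v = "\<lambda>z. 1 / (exp (?c * z) - 1)"
  obtain P where P: "coeffs_in \<rat> P" "\<And>z. z \<notin> \<int> \<Longrightarrow>
     (-1) ^ n * Polygamma n (1 - z) - Polygamma n z = ?c ^ Suc n * poly P (?v z)"
    using Suc.IH by blast
  define Q where "Q = smult (-1) ([:0, 1, 1:] * pderiv P)"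
  have "coeffs_in \<rat> Q" unfolding Q_def
    by (intro coeffs_in_smult[OF subring_set_Rats] coeffs_in_mult[OF subring_set_Rats]
          coeffs_in_pderiv[OF subring_set_Rats] P)
       (simp_all add: coeffs_in_pCons[OF subring_set_Rats] coeffs_in_0[OF subring_set_Rats])
  moreover have "(-1) ^ Suc n * Polygamma (Suc n) (1 - z) - Polygamma (Suc n) z
      = ?c ^ Suc (Suc n) * poly Q (?v z)" if z: "z \<notin> \<int>" for z
  proof -
    have z1: "1 - z \<notin> \<int>" using z by (metis Ints_1 Ints_diff diff_diff_eq2 add_diff_cancel_left')
    then have nz: "z \<notin> \<int>\<^sub>\<le>\<^sub>0" "1 - z \<notin> \<int>\<^sub>\<le>\<^sub>0" using z nonpos_Ints_Int by blast+
    have e: "exp (?c * z) - 1 \<noteq> 0" using cot_exp(2)[OF z] by simp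
    have d: "((\<lambda>z. (-1) ^ n * Polygamma n (1 - z) - Polygamma n z) has_field_derivative
      (-1) ^ Suc n * Polygamma (Suc n) (1 - z) - Polygamma (Suc n) z) (at z)"
      using nz by (auto intro!: derivative_eq_intros)
    have alg: "- (?c * (u + 1)) / u\<^sup>2 = - (?c * (1 / u + (1 / u)\<^sup>2))" if "u \<noteq> 0" for u :: complex
      using that by (simp add: field_simps power2_eq_square)
    have "(?v has_field_derivative - (?c * exp (?c * z)) / (exp (?c * z) - 1)\<^sup>2) (at z)"
      using e by (auto intro!: derivative_eq_intros simp: power2_eq_square)
    then have v: "(?v has_field_derivative - (?c * (?v z + (?v z)\<^sup>2))) (at z)"
      using alg[OF e] by simp
    have d': "((\<lambda>z. ?c ^ Suc n * poly P (?v z)) has_field_derivative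
       ?c ^ Suc n * (- (?c * (?v z + (?v z)\<^sup>2)) * poly (pderiv P) (?v z))) (at z)"
      by (intro DERIV_cmult DERIV_chain2[OF poly_DERIV v, THEN DERIV_cong]) simp
    \<comment> \<open>The identity to be differentiated holds off the integers only; their
      complement is open, so it holds near \<open>z\<close>.\<close>
    have "eventually (\<lambda>z. z \<in> - \<int>) (nhds z)"
      using z by (intro eventually_nhds_in_open) (auto simp: open_Compl closed_Ints)
    then have ev: "eventually (\<lambda>z. (-1) ^ n * Polygamma n (1 - z) - Polygamma n z
        = ?c ^ Suc n * poly P (?v z)) (nhds z)"
      by eventually_elim (simp add: P(2))
    have "(-1) ^ Suc n * Polygamma (Suc n) (1 - z) - Polygamma (Suc n) z
        = ?c ^ Suc n * (- (?c * (?v z + (?v z)\<^sup>2)) * poly (pderiv P) (?v z))"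
      by (rule DERIV_unique[OF DERIV_cong_ev[OF refl ev refl, THEN iffD1, OF d] d'])
    also have "\<dots> = ?c ^ Suc (Suc n) * poly Q (?v z)"
      by (simp add: Q_def power2_eq_square algebra_simps)
    finally show ?thesis .
  qed
  ultimately show ?case by blast
qed

section \<open>Hurwitz zeta values as cyclotomic numbers\<close>

text \<open>The real form of \<open>hurwitz_zeta\<close> at integers above 1, for use with
  inequalities.\<close>

definition hurwitz_real :: "nat \<Rightarrow> real \<Rightarrow> real" where
  "hurwitz_real k x = (\<Sum>n. 1 / (real n + x) ^ k)"

lemma hurwitz_real_sums_Polygamma:
  assumes "k > 1" "x > 0"
  shows "(\<lambda>n. 1 / (real n + x) ^ k) sums hurwitz_real k x"
    and "Polygamma (k - 1) x = (-1) ^ k * fact (k - 1) * hurwitz_real k x"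
proof -
  have *: "(\<lambda>n. 1 / (real n + x) ^ k) sums ((-1) ^ k * Polygamma (k - 1) x / fact (k - 1))"
    using Polygamma_LIMSEQ[of x "k - 1"] assms by (simp add: inverse_eq_divide add.commute)
  then show "(\<lambda>n. 1 / (real n + x) ^ k) sums hurwitz_real k x" by (simp add: hurwitz_real_def sums_iff)
  show "Polygamma (k - 1) x = (-1) ^ k * fact (k - 1) * hurwitz_real k x"
    using * by (simp add: hurwitz_real_def sums_iff)
qed

lemma hurwitz_zeta_of_nat:
  assumes "k > 1" "x > 0"
  shows "hurwitz_zeta (of_nat k) x = of_real (hurwitz_real k x)"
proof -
  have "complex_of_real (real n + x) powr (- of_nat k) = of_real (1 / (real n + x) ^ k)" for n
  proof -
    have "complex_of_real (real n + x) \<noteq> 0" using assms(2) by (simp only: of_real_eq_0_iff)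
    then show ?thesis by (simp add: powr_minus powr_nat inverse_eq_divide del: of_real_add)
  qed
  moreover have "summable (\<lambda>n. 1 / (real n + x) ^ k)"
    using hurwitz_real_sums_Polygamma(1)[OF assms] by (rule sums_summable)
  ultimately show ?thesis
    unfolding hurwitz_zeta_def hurwitz_real_def by (simp only: suminf_of_real)
qed

lemma hurwitz_real_reflection_poly:
  assumes k: "k > 1"
  obtains P where "coeffs_in \<rat> P"
    "\<And>x. 0 < x \<Longrightarrow> x < 1 \<Longrightarrow> of_real (hurwitz_real k x + (-1) ^ k * hurwitz_real k (1 - x))
       = (2 * of_real pi * \<i>) ^ k * poly P (1 / (exp (2 * of_real pi * \<i> * of_real x) - 1))"
proof -
  let ?v = "\<lambda>z. 1 / (exp (2 * of_real pi * \<i> * z) - 1)"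
  obtain P where P: "coeffs_in \<rat> P" "\<And>z. z \<notin> \<int> \<Longrightarrow>
     (-1) ^ (k - 1) * Polygamma (k - 1) (1 - z) - Polygamma (k - 1) z
       = (2 * of_real pi * \<i>) ^ k * poly P (?v z)"
    using Polygamma_reflection_poly[of "k - 1"] k by auto
  \<comment> \<open>Since Polygamma (k - 1) is (-1)^k (k - 1)! times the zeta value, the polygamma
    combination is the reflected zeta sum times 1 / \<open>c\<close>.\<close>
  define c :: complex where "c = - ((-1) ^ k) / fact (k - 1)"
  show ?thesis
  proof
    have "(fact (k - 1) :: complex) \<in> \<rat>" by (metis Rats_of_nat of_nat_fact)
    then have "c \<in> \<rat>" unfolding c_def by (intro Rats_divide) simp_all
    then show "coeffs_in \<rat> (smult c P)" by (rule coeffs_in_smult[OF subring_set_Rats _ P(1)])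
    fix x :: real assume x: "0 < x" "x < 1"
    have "x \<notin> \<int>" using x by (auto elim!: Ints_cases)
    then have "complex_of_real x \<notin> \<int>" by (metis Ints_cases Ints_of_int of_real_eq_iff of_real_of_int_eq)
    have "(-1) ^ (k - 1) * Polygamma (k - 1) (1 - x) - Polygamma (k - 1) x
        = - ((-1) ^ k) * fact (k - 1) * (hurwitz_real k x + (-1) ^ k * hurwitz_real k (1 - x))"
      using hurwitz_real_sums_Polygamma(2)[OF k, of x] hurwitz_real_sums_Polygamma(2)[OF k, of "1 - x"] x k
      by (cases k) (simp_all add: algebra_simps)
    then have "complex_of_real (hurwitz_real k x + (-1) ^ k * hurwitz_real k (1 - x)) =
        c * of_real ((-1) ^ (k - 1) * Polygamma (k - 1) (1 - x) - Polygamma (k - 1) x)"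
      by (simp add: c_def)
    also have "of_real ((-1) ^ (k - 1) * Polygamma (k - 1) (1 - x) - Polygamma (k - 1) x) =
       (-1) ^ (k - 1) * Polygamma (k - 1) (1 - complex_of_real x) - Polygamma (k - 1) (complex_of_real x)"
      using Polygamma_of_real[of x "k - 1", where ?'a = complex]
        Polygamma_of_real[of "1 - x" "k - 1", where ?'a = complex] x by simp
    also have "\<dots> = (2 * of_real pi * \<i>) ^ k * poly P (?v (of_real x))"
      by (rule P(2)) fact
    finally show "of_real (hurwitz_real k x + (-1) ^ k * hurwitz_real k (1 - x))
       = (2 * of_real pi * \<i>) ^ k * poly (smult c P) (?v (of_real x))"
      by (simp add: mult_ac)
  qed
qed

text \<open>Makes 1 / (y - 1) a rational polynomial in y, the same for all such y. The telescoping
  identity for (y - 1) \<Sum> j y^j leaves only q, because the geometric sum of y vanishes.\<close>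

lemma inverse_root_of_unity_minus_1:
  fixes y :: complex
  assumes "y ^ q = 1" "y \<noteq> 1" "q > 0"
  shows "1 / (y - 1) = (\<Sum>j<q. of_nat j / of_nat q * y ^ j)"
proof -
  have "(y - 1) * (\<Sum>j<n. of_nat j * y ^ j) = of_nat n * y ^ n - y * (\<Sum>j<n. y ^ j)" for n
    by (induction n) (simp_all add: algebra_simps)
  moreover have "(\<Sum>j<q. y ^ j) = 0"
    using power_diff_1_eq[of y q] assms by simp
  ultimately have "(y - 1) * (\<Sum>j<q. of_nat j * y ^ j) = of_nat q" using assms by simp
  moreover have "(\<Sum>j<q. of_nat j / of_nat q * y ^ j) = (\<Sum>j<q. of_nat j * y ^ j) / of_nat q"
    by (simp add: sum_divide_distrib)
  ultimately have "(y - 1) * (\<Sum>j<q. of_nat j / of_nat q * y ^ j) = 1" using assms by simp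
  then show ?thesis by (metis mult_zero_left nonzero_mult_div_cancel_left zero_neq_one)
qed

text \<open>One \<open>P\<close> serves all \<open>a\<close>; hence raising the root of unity to the
  power b moves the value at a to the value at a * b modulo \<open>q\<close>.\<close>

lemma hurwitz_real_cyclotomic:
  assumes k: "k > 1" and q: "q > 0"
  obtains P where "coeffs_in \<rat> P"
    "\<And>a. 0 < a \<Longrightarrow> a < q \<Longrightarrow>
       of_real (hurwitz_real k (real a / real q) + (-1) ^ k * hurwitz_real k (1 - real a / real q))
       = (2 * of_real pi * \<i>) ^ k * poly P (exp (2 * of_real pi * \<i> / of_nat q) ^ a)"
proof -
  obtain P where P: "coeffs_in \<rat> P"
    "\<And>x. 0 < x \<Longrightarrow> x < 1 \<Longrightarrow> of_real (hurwitz_real k x + (-1) ^ k * hurwitz_real k (1 - x))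
       = (2 * of_real pi * \<i>) ^ k * poly P (1 / (exp (2 * of_real pi * \<i> * of_real x) - 1))"
    using hurwitz_real_reflection_poly[OF k] by blast
  define W :: "complex poly" where "W = (\<Sum>j<q. monom (of_nat j / of_nat q) j)"
  have "coeffs_in \<rat> W"
    using subring_set_sum[OF subring_set_coeffs_in[OF subring_set_Rats], of "{..<q}"
        "\<lambda>j. monom (of_nat j / of_nat q) j"]
    by (simp add: W_def coeffs_in_monom[OF subring_set_Rats])
  show ?thesis
  proof
    show "coeffs_in \<rat> (pcompose P W)"
      by (rule coeffs_in_pcompose[OF subring_set_Rats P(1)]) fact
    fix a assume a: "0 < a" "a < q"
    define x where "x = real a / real q"
    have x: "0 < x" "x < 1" using a by (simp_all add: x_def)
    define y where "y = exp (2 * of_real pi * \<i> * of_real x)"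
    have y: "exp (2 * of_real pi * \<i> / of_nat q) ^ a = y"
      by (simp add: y_def x_def exp_of_nat_mult[symmetric] mult_ac)
    have "x \<notin> \<int>" using x by (auto elim!: Ints_cases)
    then have "complex_of_real x \<notin> \<int>" by (metis Ints_cases Ints_of_int of_real_eq_iff of_real_of_int_eq)
    then have "y \<noteq> 1" unfolding y_def by (rule cot_exp(2))
    moreover have "exp (2 * of_real pi * \<i> / of_nat q) ^ q = 1"
      using q by (simp add: exp_of_nat_mult[symmetric] exp_two_pi_i)
    then have "y ^ q = 1" unfolding y[symmetric] by (metis mult.commute power_mult power_one)
    ultimately have "poly W y = 1 / (y - 1)"
      using inverse_root_of_unity_minus_1[of y q] q by (simp add: W_def poly_sum poly_monom)
    then show "of_real (hurwitz_real k (real a / real q) + (-1) ^ k * hurwitz_real k (1 - real a / real q))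
       = (2 * of_real pi * \<i>) ^ k * poly (pcompose P W) (exp (2 * of_real pi * \<i> / of_nat q) ^ a)"
      using P(2)[OF x] unfolding y by (simp add: poly_pcompose x_def y_def)
  qed
qed

section \<open>Dominance of the value at 1/q\<close>

lemma inverse_squares_lt_2: "pi\<^sup>2 / 6 < 2"
proof -
  have "pi\<^sup>2 \<le> (3.2)\<^sup>2" using pi_approx by (intro power_mono) auto
  then show ?thesis by (simp add: power2_eq_square)
qed

lemma hurwitz_real_pos: "k > 1 \<Longrightarrow> x > 0 \<Longrightarrow> hurwitz_real k x > 0"
  using hurwitz_real_sums_Polygamma(1)[of k x] unfolding hurwitz_real_def
  by (intro suminf_pos) (auto simp: sums_iff)

text \<open>Grouping the series of \<zeta>(k) into blocks of length \<open>q\<close> shows that the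
  left side is q^k \<zeta>(k). Here \<zeta>(k) \<le> \<zeta>(2) < 2, while q^k is already the first
  term of \<zeta>(k, 1/q).\<close>

lemma hurwitz_real_sum_lt:
  assumes k: "k > 1" and q: "q > 0"
  shows "(\<Sum>j\<in>{1..q}. hurwitz_real k (real j / real q)) < 2 * hurwitz_real k (1 / real q)"
proof -
  have sm: "(\<lambda>n. 1 / (real n + 1) ^ k) sums hurwitz_real k 1" using hurwitz_real_sums_Polygamma(1)[OF k, of 1] by simp
  have sums: "(\<lambda>n. 1 / (real n + real j / real q) ^ k) sums hurwitz_real k (real j / real q)" if "j \<ge> 1" for j
    using hurwitz_real_sums_Polygamma(1)[OF k] q that by simp
  have "(\<lambda>n. \<Sum>j\<in>{1..q}. 1 / (real n + real j / real q) ^ k)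
      sums (\<Sum>j\<in>{1..q}. hurwitz_real k (real j / real q))"
    by (intro sums_sum sums) auto
  moreover have "(\<Sum>j\<in>{1..q}. 1 / (real n + real j / real q) ^ k)
      = real q ^ k * (\<Sum>m\<in>{n * q..<n * q + q}. 1 / (real m + 1) ^ k)" for n
  proof -
    have "(\<Sum>j\<in>{1..q}. 1 / (real n + real j / real q) ^ k) =
        (\<Sum>m\<in>{n * q..<n * q + q}. real q ^ k * (1 / (real m + 1) ^ k))"
    proof (rule sum.reindex_bij_witness[of _ "\<lambda>m. m + 1 - n * q" "\<lambda>j. n * q + j - 1"])
      \<comment> \<open>The term with indices n, j has denominator base (n q + j) / q, and n q + j =
        m + 1.\<close>
      fix j assume j: "j \<in> {1..q}"
      have "real n + real j / real q = (real (n * q + j - 1) + 1) / real q"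
        using q j by (simp add: field_simps of_nat_diff)
      then show "real q ^ k * (1 / (real (n * q + j - 1) + 1) ^ k) = 1 / (real n + real j / real q) ^ k"
        by (simp add: power_divide)
    qed auto
    then show ?thesis by (simp add: sum_distrib_left)
  qed
  moreover have "(\<lambda>n. real q ^ k * (\<Sum>m\<in>{n * q..<n * q + q}. 1 / (real m + 1) ^ k))
      sums (real q ^ k * hurwitz_real k 1)"
    by (intro sums_mult sums_group sm q)
  ultimately have "(\<Sum>j\<in>{1..q}. hurwitz_real k (real j / real q)) = real q ^ k * hurwitz_real k 1"
    by (simp add: sums_iff)
  also have "hurwitz_real k 1 \<le> pi\<^sup>2 / 6"
  proof (rule sums_le[OF _ sm])
    show "(\<lambda>n. 1 / (real n + 1)\<^sup>2) sums (pi\<^sup>2 / 6)"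
      using inverse_squares_sums by (simp add: add.commute)
    show "1 / (real n + 1) ^ k \<le> 1 / (real n + 1)\<^sup>2" for n
      using k by (intro divide_left_mono power_increasing) auto
  qed
  also have "pi\<^sup>2 / 6 < 2" by (rule inverse_squares_lt_2)
  also have "real q ^ k * 2 \<le> 2 * hurwitz_real k (1 / real q)"
  proof -
    have "real q ^ k = (\<Sum>n<1. 1 / (real n + 1 / real q) ^ k)" by (simp add: power_divide)
    also have "\<dots> \<le> hurwitz_real k (1 / real q)"
      unfolding hurwitz_real_def using hurwitz_real_sums_Polygamma(1)[OF k, of "1 / real q"] q
      by (intro sum_le_suminf) (auto simp: sums_iff)
    finally show ?thesis by simp
  qed
  finally show ?thesis using q by simp
qed

section \<open>Linear independence\<close>

text \<open>For q > 2, one representative of each pair a, q - a of totatives.\<close>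

definition half_totatives :: "nat \<Rightarrow> nat set" where
  "half_totatives q = {a. 0 < a \<and> 2 * a < q \<and> coprime a q}"

lemma finite_half_totatives: "finite (half_totatives q)"
  by (rule finite_subset[of _ "{..q}"]) (auto simp: half_totatives_def)

lemma coprime_reflect:
  fixes a q :: nat
  assumes "coprime a q" "a \<le> q"
  shows "coprime (q - a) q"
  using assms by (intro coprimeI) (meson coprime_common_divisor dvd_diffD1)

lemma coprime_mod_pos:
  fixes x q :: nat
  assumes "coprime x q" "q > 1"
  shows "x mod q > 0"
proof (rule ccontr)
  assume "\<not> x mod q > 0"
  then have "q dvd x" by (simp add: dvd_eq_mod_eq_0)
  then have "is_unit q" using assms(1) coprime_common_divisor dvd_refl by blast
  then show False using assms(2) by simp
qed

lemma totient_le_half_totatives: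
  assumes "q > 2"
  shows "totient q \<le> 2 * card (half_totatives q)"
proof -
  let ?A = "half_totatives q"
  have "totatives q \<subseteq> ?A \<union> (\<lambda>a. q - a) ` ?A"
  proof
    fix a assume a: "a \<in> totatives q"
    then have aq: "0 < a" "a \<le> q" "coprime a q" by (auto simp: totatives_def)
    have "a \<noteq> q" using aq assms by auto
    \<comment> \<open>Otherwise a divides q, and coprimality forces a = 1 and q = 2.\<close>
    have "2 * a \<noteq> q" using aq assms by auto
    show "a \<in> ?A \<union> (\<lambda>a. q - a) ` ?A"
    proof (cases "2 * a < q")
      case True
      then show ?thesis using aq by (simp add: half_totatives_def)
    next
      case False
      have "coprime (q - a) q"
        using aq by (intro coprime_reflect)
      then have "q - a \<in> ?A" using False aq \<open>a \<noteq> q\<close> \<open>2 * a \<noteq> q\<close> by (auto simp: half_totatives_def)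
      moreover have "a = q - (q - a)" using aq by simp
      ultimately show ?thesis by blast
    qed
  qed
  then have "totient q \<le> card (?A \<union> (\<lambda>a. q - a) ` ?A)"
    unfolding totient_def using finite_half_totatives by (intro card_mono) auto
  also have "\<dots> \<le> card ?A + card ((\<lambda>a. q - a) ` ?A)" by (rule card_Un_le)
  also have "card ((\<lambda>a. q - a) ` ?A) \<le> card ?A" using finite_half_totatives by (rule card_image_le)
  finally show ?thesis by simp
qed

text \<open>Multiplication by \<open>b\<close> permutes residues and respects a -> q - a, so the
  residues on the left are pairwise distinct elements of 1..q: the left side is a partial sum of the
  right.\<close>

lemma half_totatives_sum_le:
  fixes h :: "nat \<Rightarrow> real"
  assumes b: "coprime b q" and q: "q > 2" and h: "\<And>j. j > 0 \<Longrightarrow> h j \<ge> 0"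
  shows "(\<Sum>a\<in>half_totatives q. h (b * a mod q) + h (q - b * a mod q)) \<le> (\<Sum>j\<in>{1..q}. h j)"
proof -
  let ?A = "half_totatives q"
  define m where "m a = b * a mod q" for a
  have m: "0 < m a" "m a < q" if "a \<in> ?A" for a
  proof -
    have "coprime (b * a) q" using b that by (simp add: half_totatives_def)
    then show "0 < m a" unfolding m_def using q by (intro coprime_mod_pos) auto
    show "m a < q" using q by (simp add: m_def)
  qed
  have inj: "inj_on m ?A"
  proof (rule inj_onI)
    fix x y assume xy: "x \<in> ?A" "y \<in> ?A" "m x = m y"
    then have "[x = y] (mod q)" using b by (simp add: m_def cong_def[symmetric] cong_mult_lcancel_nat)
    then show "x = y" using xy by (simp add: cong_less_modulus_unique_nat half_totatives_def)
  qed
  have inj': "inj_on (\<lambda>a. q - m a) ?A"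
  proof (rule inj_onI)
    fix x y assume xy: "x \<in> ?A" "y \<in> ?A" "q - m x = q - m y"
    then have "m x = m y" using m(2)[of x] m(2)[of y] by linarith
    then show "x = y" using inj xy by (auto dest: inj_onD)
  qed
  \<comment> \<open>A collision makes q divide b (x + y), hence x + y, although 0 < x + y <
    q.\<close>
  have disj: "m ` ?A \<inter> (\<lambda>a. q - m a) ` ?A = {}"
  proof (rule ccontr)
    assume "\<not> ?thesis"
    then obtain x y where xy: "x \<in> ?A" "y \<in> ?A" "m x = q - m y" by blast
    then have "m x + m y = q" using m(2)[of y] by simp
    then have "(b * x + b * y) mod q = 0" unfolding m_def by (metis mod_add_eq mod_self)
    then have "q dvd b * (x + y)" by (simp add: algebra_simps dvd_eq_mod_eq_0)
    then have "q dvd x + y" using b by (simp add: coprime_commute coprime_dvd_mult_right_iff)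
    then have "q \<le> x + y" using xy(1) by (intro dvd_imp_le) (auto simp: half_totatives_def)
    then show False using xy by (simp add: half_totatives_def)
  qed
  have "(\<Sum>a\<in>?A. h (m a) + h (q - m a)) = sum h (m ` ?A) + sum h ((\<lambda>a. q - m a) ` ?A)"
    using inj inj' by (simp add: sum.distrib sum.reindex)
  also have "\<dots> = sum h (m ` ?A \<union> (\<lambda>a. q - m a) ` ?A)"
    using disj finite_half_totatives by (simp add: sum.union_disjoint)
  also have "\<dots> \<le> sum h {1..q}"
    using m h by (intro sum_mono2) (auto simp: Suc_le_eq less_imp_le)
  finally show ?thesis by (simp add: m_def)
qed

lemma complex_of_real_of_rat: "complex_of_real (real_of_rat r) = of_rat r"
  by (cases r) (simp add: of_rat_rat)

text \<open>Conjugate the relation by the inverse of an index \<open>a\<^sub>0\<close> with \<open>\<bar>r a\<^sub>0\<bar>\<close> maximal: the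
  coefficient \<open>r a\<^sub>0\<close> then multiplies the value at \<open>1 / q\<close>, which exceeds all others together.\<close>

lemma hurwitz_real_reflected_independent:
  fixes r :: "nat \<Rightarrow> rat"
  assumes k: "k > 1" and q: "q > 2"
    and rel: "(\<Sum>a\<in>half_totatives q.
      real_of_rat (r a) *
        (hurwitz_real k (real a / real q) + (-1) ^ k * hurwitz_real k (1 - real a / real q))) = 0"
    and a: "a \<in> half_totatives q"
  shows "r a = 0"
proof (rule ccontr)
  assume "r a \<noteq> 0"
  let ?A = "half_totatives q"
  define C where "C a = hurwitz_real k (real a / real q)
      + (-1) ^ k * hurwitz_real k (1 - real a / real q)" for a :: nat
  define w where "w = exp (2 * of_real pi * \<i> / complex_of_nat q)"
  have q0: "q > 0" using q by simp
  have w: "w ^ q = 1" using q by (simp add: w_def exp_of_nat_mult[symmetric] exp_two_pi_i)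
  obtain P where P: "coeffs_in \<rat> P"
    "\<And>a. 0 < a \<Longrightarrow> a < q \<Longrightarrow> of_real (C a) = (2 * of_real pi * \<i>) ^ k * poly P (w ^ a)"
    using hurwitz_real_cyclotomic[OF k q0] unfolding C_def w_def by blast
  define g where "g = (\<Sum>a\<in>?A. smult (of_rat (r a)) (pcompose P (monom 1 a)))"
  have "coeffs_in \<rat> (smult (of_rat (r a)) (pcompose P (monom 1 a)))" for a
    by (intro coeffs_in_smult[OF subring_set_Rats] coeffs_in_pcompose[OF subring_set_Rats] P
         coeffs_in_monom[OF subring_set_Rats]) auto
  then have g: "coeffs_in \<rat> g"
    using subring_set_sum[OF subring_set_coeffs_in[OF subring_set_Rats], of ?A
        "\<lambda>a. smult (of_rat (r a)) (pcompose P (monom 1 a))"] by (simp add: g_def)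
  \<comment> \<open>Up to a nonzero factor, \<open>g\<close> at \<open>w ^ b\<close> is the left
    side of the relation with every index multiplied by \<open>b\<close>.\<close>
  have poly_g: "(2 * of_real pi * \<i>) ^ k * poly g (w ^ b) =
      of_real (\<Sum>a\<in>?A. real_of_rat (r a) * C (b * a mod q))" if "coprime b q" for b
  proof -
    have "(2 * of_real pi * \<i>) ^ k * (of_rat (r a) * poly P ((w ^ b) ^ a))
        = of_real (real_of_rat (r a) * C (b * a mod q))" if "a \<in> ?A" for a
    proof -
      have "coprime (b * a) q" using \<open>coprime b q\<close> that by (simp add: half_totatives_def)
      then have "b * a mod q > 0" using q by (intro coprime_mod_pos) auto
      moreover have "(w ^ b) ^ a = w ^ (b * a mod q)"
        using root_of_unity_mod[OF w, of "b * a"] by (simp add: power_mult)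
      ultimately show ?thesis using P(2)[of "b * a mod q"] q by (simp add: mult_ac complex_of_real_of_rat)
    qed
    then show ?thesis
      by (simp add: g_def poly_sum poly_pcompose poly_monom sum_distrib_left)
  qed
  have nz: "(2 * of_real pi * \<i>) ^ k \<noteq> (0 :: complex)" by simp
  have "b * a mod q = a" if "b = 1" "a \<in> ?A" for a b using that by (simp add: half_totatives_def)
  then have "(\<Sum>a\<in>?A. real_of_rat (r a) * C (1 * a mod q)) = 0"
    using rel unfolding C_def[symmetric] by simp
  then have "poly g w = 0" using poly_g[of 1] nz by simp
  then have conj: "(\<Sum>a\<in>?A. real_of_rat (r a) * C (b * a mod q)) = 0" if "coprime b q" for b
    using root_of_unity_conj[OF q0 w g _ that] poly_g[OF that] by (metis mult_zero_right of_real_eq_0_iff)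
  define R where "R a = \<bar>real_of_rat (r a)\<bar>" for a
  obtain a0 where a0: "a0 \<in> ?A" "\<And>a. a \<in> ?A \<Longrightarrow> R a \<le> R a0"
  proof -
    have "Max (R ` ?A) \<in> R ` ?A" using a finite_half_totatives by (intro Max_in) auto
    then obtain a0 where "a0 \<in> ?A" "R a0 = Max (R ` ?A)" by auto
    then show ?thesis using that finite_half_totatives by simp
  qed
  have "R a > 0" using \<open>r a \<noteq> 0\<close> by (simp add: R_def)
  then have R0: "R a0 > 0" using a0(2)[OF a] by linarith
  \<comment> \<open>The inverse of \<open>a0\<close> modulo \<open>q\<close> moves the index
    \<open>a0\<close> to 1.\<close>
  obtain b where b: "[a0 * b = Suc 0] (mod q)"
    using cong_solve_coprime_nat[of a0 q] a0(1) by (auto simp: half_totatives_def)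
  then have bq: "coprime b q" by (metis One_nat_def coprime_iff_invertible_nat mult.commute)
  have ba0: "b * a0 mod q = 1" using b q by (simp add: cong_def mult.commute)
  define h where "h j = hurwitz_real k (real j / real q)" for j
  define m where "m a = b * a mod q" for a
  have h_pos: "h j > 0" if "j > 0" for j unfolding h_def using that q by (intro hurwitz_real_pos k) simp
  have m: "0 < m a" "m a < q" if "a \<in> ?A" for a
  proof -
    have "coprime (b * a) q" using bq that by (simp add: half_totatives_def)
    then show "0 < m a" unfolding m_def using q by (intro coprime_mod_pos) auto
    show "m a < q" using q by (simp add: m_def)
  qed
  have C: "C j = h j + (-1) ^ k * h (q - j)" if "j < q" for j
    using that q by (simp add: C_def h_def of_nat_diff diff_divide_distrib)
  have s: "(-1 :: real) ^ k = 1 \<or> (-1 :: real) ^ k = -1" by (cases "even k") auto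
  have C_le: "\<bar>C (m a)\<bar> \<le> h (m a) + h (q - m a)" if "a \<in> ?A" for a
    using C[OF m(2)[OF that]] h_pos[OF m(1)[OF that]] h_pos[of "q - m a"] m(2)[OF that] s by auto
  have m0: "m a0 = 1" by (simp add: m_def ba0)
  \<comment> \<open>Depending on the parity of \<open>k\<close>, \<open>C 1\<close> is the sum or
    the difference of h 1 and h (q - 1); this bound covers both.\<close>
  have C_ge: "\<bar>C 1\<bar> \<ge> h 1 - h (q - 1)"
    using C[of 1] h_pos[of 1] h_pos[of "q - 1"] q s by auto
  have "0 = (\<Sum>a\<in>?A. real_of_rat (r a) * C (m a))" using conj[OF bq] by (simp add: m_def)
  also have "\<dots> = real_of_rat (r a0) * C 1 + (\<Sum>a\<in>?A - {a0}. real_of_rat (r a) * C (m a))"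
    using a0(1) finite_half_totatives by (subst sum.remove[of _ a0]) (auto simp: m0)
  finally have "R a0 * \<bar>C 1\<bar> = \<bar>\<Sum>a\<in>?A - {a0}. real_of_rat (r a) * C (m a)\<bar>"
    unfolding R_def abs_mult[symmetric] by linarith
  also have "\<dots> \<le> (\<Sum>a\<in>?A - {a0}. \<bar>real_of_rat (r a) * C (m a)\<bar>)" by (rule sum_abs)
  also have "\<dots> \<le> (\<Sum>a\<in>?A - {a0}. R a0 * (h (m a) + h (q - m a)))"
    unfolding abs_mult using a0(2) C_le R0 by (intro sum_mono mult_mono) (auto simp: R_def)
  finally have "R a0 * \<bar>C 1\<bar> \<le> R a0 * (\<Sum>a\<in>?A - {a0}. h (m a) + h (q - m a))"
    by (simp add: sum_distrib_left)
  then have "\<bar>C 1\<bar> \<le> (\<Sum>a\<in>?A - {a0}. h (m a) + h (q - m a))" using R0 by simp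
  \<comment> \<open>Completing the sum by its \<open>a0\<close> term bounds it by the full sum,
    which is below 2 h 1. So |C 1| < h 1 - h (q - 1), against \<open>C_ge\<close>.\<close>
  also have "\<dots> = (\<Sum>a\<in>?A. h (m a) + h (q - m a)) - (h 1 + h (q - 1))"
    using a0(1) finite_half_totatives by (simp add: sum_diff1 m0)
  also have "(\<Sum>a\<in>?A. h (m a) + h (q - m a)) \<le> (\<Sum>j\<in>{1..q}. h j)"
    unfolding m_def by (rule half_totatives_sum_le[OF bq q]) (use h_pos in \<open>auto intro: less_imp_le\<close>)
  also have "\<dots> < 2 * h 1" unfolding h_def using hurwitz_real_sum_lt[OF k q0] by simp
  finally show False using C_ge by linarith
qed

theorem theorem5p2:
  fixes k q :: nat
  assumes "k > 1" and "q > 2"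
  shows "real (rat_space.dim (S k q)) \<ge> real (totient q) / 2"
proof -
  let ?A = "half_totatives q"
  define Z where "Z a = hurwitz_zeta (of_nat k) (real a / real q) / of_real pi ^ k" for a
  define X where "X = {Z a | a. 1 \<le> a \<and> a < q \<and> coprime a q}"
  have S: "S k q = rat_space.span X" by (simp add: S_def X_def Z_def)
  have "X \<subseteq> Z ` {..q}" by (auto simp: X_def)
  then have finX: "finite X" by (rule finite_subset) simp
  define C where "C a = hurwitz_real k (real a / real q)
      + (-1) ^ k * hurwitz_real k (1 - real a / real q)" for a :: nat
  define f where "f a = complex_of_real (C a / pi ^ k)" for a
  have fS: "f ` ?A \<subseteq> S k q"
  proof (rule image_subsetI)
    fix a assume "a \<in> ?A"
    then have a: "0 < a" "2 * a < q" "coprime a q" by (auto simp: half_totatives_def)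
    have "coprime (q - a) q"
      using a by (intro coprime_reflect) auto
    then have "Z a \<in> X" "Z (q - a) \<in> X" using a unfolding X_def by force+
    then have "Z a + rat_scale ((-1) ^ k) (Z (q - a)) \<in> S k q"
      unfolding S by (intro rat_space.span_add rat_space.span_scale rat_space.span_base)
    moreover have "real (q - a) / real q = 1 - real a / real q"
      using a by (simp add: of_nat_diff diff_divide_distrib)
    then have "Z a + rat_scale ((-1) ^ k) (Z (q - a)) = f a"
      using a assms(1) by (simp add: Z_def f_def C_def hurwitz_zeta_of_nat rat_scale_def of_rat_power
          of_rat_minus add_divide_distrib)
    ultimately show "f a \<in> S k q" by simp
  qed
  have zero: "\<forall>a\<in>?A. r a = 0" if "(\<Sum>a\<in>?A. rat_scale (r a) (f a)) = 0" for r
  proof -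
    have "(\<Sum>a\<in>?A. rat_scale (r a) (f a)) = of_real ((\<Sum>a\<in>?A. real_of_rat (r a) * C a) / pi ^ k)"
      by (simp add: rat_scale_def f_def sum_divide_distrib complex_of_real_of_rat)
    then have "complex_of_real ((\<Sum>a\<in>?A. real_of_rat (r a) * C a) / pi ^ k) = 0" using that by (simp only:)
    then have "(\<Sum>a\<in>?A. real_of_rat (r a) * C a) = 0" unfolding of_real_eq_0_iff by simp
    then show ?thesis using hurwitz_real_reflected_independent[OF assms] unfolding C_def by blast
  qed
  \<comment> \<open>Equal values at distinct indices would give a relation with coefficients 1 and
    -1; injectivity ensures that the image has as many elements as the index set.\<close>
  have inj: "inj_on f ?A"
  proof (rule inj_onI, rule ccontr)
    fix x y assume xy: "x \<in> ?A" "y \<in> ?A" "f x = f y" "x \<noteq> y"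
    define r :: "nat \<Rightarrow> rat" where "r a = (if a = x then 1 else if a = y then -1 else 0)" for a
    have "(\<Sum>a\<in>?A. rat_scale (r a) (f a)) = (\<Sum>a\<in>{x, y}. rat_scale (r a) (f a))"
      using xy finite_half_totatives by (intro sum.mono_neutral_right) (auto simp: r_def rat_scale_def)
    also have "\<dots> = 0" using xy by (simp add: r_def rat_scale_def)
    finally show False using zero[of r] xy(1) by (auto simp: r_def)
  qed
  have ind: "rat_space.independent (f ` ?A)"
  proof (rule rat_space.independent_if_scalars_zero)
    fix u x assume "(\<Sum>x\<in>f ` ?A. rat_scale (u x) x) = 0" "x \<in> f ` ?A"
    then show "u x = 0" using zero[of "u \<circ> f"] inj by (auto simp: sum.reindex)
  qed (simp add: finite_half_totatives)
  obtain B where B: "B \<subseteq> S k q" "rat_space.independent B" "S k q \<subseteq> rat_space.span B"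
      "card B = rat_space.dim (S k q)"
    using rat_space.basis_exists by blast
  \<comment> \<open>\<open>card\<close> is 0 on infinite sets, so the comparison with
    \<open>B\<close> requires its finiteness, which comes from the finite spanning set
    \<open>X\<close>.\<close>
  have "finite B" using rat_space.independent_span_bound[OF finX B(2)] B(1) S by simp
  then have "card (f ` ?A) \<le> card B"
    using rat_space.independent_span_bound[OF _ ind] fS B(3) by blast
  then have "card ?A \<le> rat_space.dim (S k q)" using inj B(4) by (simp add: card_image)
  then show ?thesis using totient_le_half_totatives[OF assms(2)] by linarith
qed

end
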